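(* For all integers $n\ge k\ge 2$ and $q\ge 2$, $$N_k(q,n)\le N_{k-1}\big((n-k+1)^{q-1},\,n\big).$$
   Context: For integers $k\ge 1$, $Q\ge 1$, $n\ge k$, a monotone path of length $n$ in the complete $k$-uniform hypergraph on $[N]$ is given by integers $j_1<\dots<j_n$ in $[N]$ together with the $k$-sets $\{j_i,\dots,j_{i+k-1}\}$, $i=1,\dots,n-k+1$. $N_k(Q,n)$ is the smallest $N$ such that every coloring of the $k$-element subsets of $[N]$ with $Q$ colors contains a monotone path of length $n$ all of whose $k$-sets have the same color. *)

theory Defs
  imports Main "HOL-Library.Ramsey"
begin

definition monotone_path :: "nat \<Rightarrow> nat \<Rightarrow> (nat \<Rightarrow> nat) \<Rightarrow> bool" where
  "monotone_path N n j \<longleftrightarrow> strict_mono_on {1..n} j \<and> j ` {1..n} \<subseteq> {1..N}"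

definition path_edges :: "nat \<Rightarrow> nat \<Rightarrow> (nat \<Rightarrow> nat) \<Rightarrow> nat set set" where
  "path_edges k n j = (\<lambda>i. j ` {i..i + k - 1}) ` {1..n - k + 1}"

text \<open>The \<open>Q\<close> colours are \<open>0, \<dots>, Q - 1\<close>; \<open>nsets A k\<close> is the set of \<open>k\<close>-element subsets of \<open>A\<close>.\<close>

definition forces_mono_path :: "nat \<Rightarrow> nat \<Rightarrow> nat \<Rightarrow> nat \<Rightarrow> bool" where
  "forces_mono_path k Q n N \<longleftrightarrow>
     (\<forall>\<chi> \<in> nsets {1..N} k \<rightarrow> {..<Q}.
        \<exists>j. monotone_path N n j \<and> (\<exists>c. \<forall>e \<in> path_edges k n j. \<chi> e = c))"

text \<open>For \<open>1 \<le> k \<le> n\<close> and \<open>Q \<ge> 1\<close> such an \<open>N\<close> exists by Ramsey's theorem, so the minimum is attained.\<close>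

definition mono_path_ramsey :: "nat \<Rightarrow> nat \<Rightarrow> nat \<Rightarrow> nat" where
  "mono_path_ramsey k Q n = (LEAST N. forces_mono_path k Q n N)"

end

theory Submission
  imports Defs
begin

text \<open>
  Let \<open>\<chi>\<close> be a \<open>q\<close>-colouring of the \<open>k\<close>-sets without a monochromatic path on \<open>n\<close> vertices. For each
  of the first \<open>q - 1\<close> colours \<open>c\<close>, let \<open>f\<^sub>c S\<close> be the largest number of edges of a path of colour
  \<open>c\<close> whose last \<open>k - 1\<close> vertices form \<open>S\<close>; it takes at most \<open>n - k + 1\<close> values. The tuple of
  the \<open>f\<^sub>c S\<close> is thus a colouring of the \<open>(k - 1)\<close>-sets with \<open>(n - k + 1)\<^sup>q\<^sup>-\<^sup>1\<close> colours. An edge of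
  colour \<open>c\<close> strictly increases \<open>f\<^sub>c\<close> from its initial to its final \<open>(k - 1)\<close>-set, so along a path
  on which the tuple is constant only the last colour can occur.
\<close>

lemma strict_mono_enumeration:
  fixes S :: "nat set"
  assumes "finite S" and "card S = n"
  obtains j where "strict_mono_on {1..n} j" and "j ` {1..n} = S"
proof -
  obtain h where h: "bij_betw h {..<card S} S" "strict_mono_on {..<card S} h"
    using ex_bij_betw_strict_mono_card[OF assms(1)] .
  have "strict_mono_on {1..n} (\<lambda>i. h (i - 1))"
    using assms(2) by (intro strict_mono_onI strict_mono_onD[OF h(2)]) auto
  moreover have "(\<lambda>i. h (i - 1)) ` {1..n} = h ` ((\<lambda>i. i - 1) ` {1..n})"
    by (simp add: image_image)
  moreover have "(\<lambda>i. i - 1) ` {1..n} = {..<n}"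
    by (force simp: image_iff intro: bexI[of _ "Suc _"])
  ultimately show thesis
    using that h(1) assms(2) by (auto simp: bij_betw_def)
qed

lemma window_in_nsets:
  fixes j :: "nat \<Rightarrow> nat"
  assumes "strict_mono_on {1..n} j" and "j ` {1..n} \<subseteq> A" and "1 \<le> i" and "i + k \<le> n + 1"
  shows "j ` {i..<i + k} \<in> nsets A k"
proof -
  have "{i..<i + k} \<subseteq> {1..n}"
    using assms(3,4) by auto
  then show ?thesis
    using assms(1,2) strict_mono_on_imp_inj_on[OF assms(1)]
    by (auto simp: nsets_def card_image inj_on_subset)
qed

text \<open>The hypothesis \<open>k < n\<close> makes the truncated difference harmless:
  \<open>n - Suc k + 1 = n - k\<close>.\<close>

lemma path_edges_Suc:
  assumes "k < n"
  shows "path_edges (Suc k) n j = (\<lambda>i. j ` {i..i + k}) ` {1..n - k}"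
  using assms by (simp add: path_edges_def Suc_diff_Suc)

text \<open>Since \<open>j\<close> increases, \<open>j a\<close> is the minimum of the first window.
  The next window is thus determined by the old window and the new vertex alone, whichever path led
  there.\<close>

lemma window_shift:
  fixes j :: "nat \<Rightarrow> nat"
  assumes "strict_mono_on {a..a + k} j" and "1 \<le> k"
  shows "j ` {Suc a..a + k} = insert (j (a + k)) (j ` {a..<a + k} - {Min (j ` {a..<a + k})})"
proof -
  have "j a \<le> j x" if "x \<in> {a..<a + k}" for x
    using that by (intro strict_mono_on_leD[OF assms(1)]) auto
  then have m: "Min (j ` {a..<a + k}) = j a"
    using assms(2) by (intro Min_eqI) auto
  have inj: "inj_on j {a..a + k}"
    using assms(1) by (rule strict_mono_on_imp_inj_on)
  have "j ` {a..<a + k} - {j a} = j ` ({a..<a + k} - {a})"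
    using inj_on_image_set_diff[OF inj, of "{a..<a + k}" "{a}"] assms(2) by fastforce
  also have "insert (j (a + k)) \<dots> = j ` insert (a + k) ({a..<a + k} - {a})"
    by simp
  also have "insert (a + k) ({a..<a + k} - {a}) = {Suc a..a + k}"
    using assms(2) by auto
  finally show ?thesis
    by (simp add: m)
qed

text \<open>Here and below \<open>k\<close> is the smaller uniformity, so edges have
  \<open>k + 1\<close> vertices and a path with \<open>m\<close> edges has \<open>m + k\<close>. The
  number \<open>f\<^sub>c S\<close> of the overview is the maximum of this set. A bare
  \<open>k\<close>-set counts as a path with \<open>m = 0\<close>, which keeps the set
  nonempty.\<close>

definition tail_lengths ::
    "(nat set \<Rightarrow> nat) \<Rightarrow> nat \<Rightarrow> nat \<Rightarrow> nat \<Rightarrow> nat set \<Rightarrow> nat set" where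
  "tail_lengths \<chi> N k c S =
     {m. \<exists>j. monotone_path N (m + k) j \<and> (\<forall>i\<in>{1..m}. \<chi> (j ` {i..i + k}) = c) \<and>
            j ` {Suc m..<Suc m + k} = S}"

lemma zero_in_tail_lengths:
  assumes "S \<in> nsets {1..N} k"
  shows "0 \<in> tail_lengths \<chi> N k c S"
proof -
  obtain j where "strict_mono_on {1..k} j" "j ` {1..k} = S"
    using strict_mono_enumeration[of S k] assms by (auto simp: nsets_def)
  then show ?thesis
    using assms by (auto simp: tail_lengths_def monotone_path_def nsets_def atLeastLessThanSuc_atLeastAtMost)
qed

text \<open>Append \<open>v\<close> to a path witnessing \<open>m\<close>: the only new edge is
  \<open>insert v S\<close>, and the window at the end slides by one.\<close>

lemma Suc_in_tail_lengths:
  assumes "m \<in> tail_lengths \<chi> N k c S" and "1 \<le> k"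
    and "v \<le> N" and "\<And>x. x \<in> S \<Longrightarrow> x < v" and "\<chi> (insert v S) = c"
  shows "Suc m \<in> tail_lengths \<chi> N k c (insert v (S - {Min S}))"
proof -
  obtain j where j: "strict_mono_on {1..m + k} j" "j ` {1..m + k} \<subseteq> {1..N}"
      "\<And>i. i \<in> {1..m} \<Longrightarrow> \<chi> (j ` {i..i + k}) = c" "j ` {Suc m..<Suc m + k} = S"
    using assms(1) by (auto simp: tail_lengths_def monotone_path_def)
  define j' where "j' = j(Suc (m + k) := v)"
  \<comment> \<open>As \<open>k\<close> is positive, \<open>S\<close> contains the last vertex of
    the path; hence \<open>v\<close>, being above \<open>S\<close>, is above the whole path, and in
    particular positive.\<close>
  have "j (m + k) \<in> S"
    unfolding j(4)[symmetric] using assms(2) by (intro imageI) auto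
  then have "j (m + k) < v"
    by (rule assms(4))
  moreover have "j x \<le> j (m + k)" if "x \<in> {1..m + k}" for x
    using that by (intro strict_mono_on_leD[OF j(1)]) auto
  ultimately have lt: "j x < v" if "x \<in> {1..m + k}" for x
    using that by (meson le_less_trans)
  have mono: "strict_mono_on {1..Suc (m + k)} j'"
    using j(1) lt by (auto simp: strict_mono_on_def j'_def le_Suc_eq)
  have range: "j' ` {1..Suc (m + k)} \<subseteq> {1..N}"
    using j(2) lt \<open>v \<le> N\<close> \<open>j (m + k) < v\<close> by (auto simp: j'_def le_Suc_eq image_subset_iff)
  have S: "j' ` {Suc m..<Suc m + k} = S"
    unfolding j(4)[symmetric] by (intro image_cong) (auto simp: j'_def)
  have v: "j' (Suc m + k) = v"
    by (simp add: j'_def)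
  have "{Suc m..Suc m + k} = insert (Suc m + k) {Suc m..<Suc m + k}"
    by auto
  then have last_edge: "j' ` {Suc m..Suc m + k} = insert v S"
    by (simp only: image_insert S v)
  have edges: "\<chi> (j' ` {i..i + k}) = c" if "i \<in> {1..Suc m}" for i
  proof (cases "i = Suc m")
    case True
    then show ?thesis
      using last_edge assms(5) by simp
  next
    case False
    then have "j' ` {i..i + k} = j ` {i..i + k}"
      using that by (intro image_cong) (auto simp: j'_def)
    then show ?thesis
      using j(3) that False by simp
  qed
  have "strict_mono_on {Suc m..Suc m + k} j'"
    using mono by (rule monotone_on_subset) auto
  then have "j' ` {Suc (Suc m)..Suc m + k} = insert v (S - {Min S})"
    using window_shift[of "Suc m" k j'] assms(2) by (simp only: S v)
  then have "j' ` {Suc (Suc m)..<Suc (Suc m) + k} = insert v (S - {Min S})"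
    by (simp add: atLeastLessThanSuc_atLeastAtMost)
  then show ?thesis
    unfolding tail_lengths_def monotone_path_def using mono range edges by auto
qed

text \<open>Otherwise the first \<open>n\<close> vertices of a witnessing path would form a
  forbidden path of colour \<open>c\<close>.\<close>

lemma tail_lengths_less:
  assumes "m \<in> tail_lengths \<chi> N k c S" and "k < n"
    and nopath: "\<And>j. monotone_path N n j \<Longrightarrow> \<not> (\<forall>e\<in>path_edges (Suc k) n j. \<chi> e = c)"
  shows "m < n - k"
proof (rule ccontr)
  assume "\<not> m < n - k"
  then have le: "n - k \<le> m" "n \<le> m + k"
    by auto
  obtain j where j: "monotone_path N (m + k) j" "\<And>i. i \<in> {1..m} \<Longrightarrow> \<chi> (j ` {i..i + k}) = c"
    using assms(1) by (auto simp: tail_lengths_def)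
  have "{1..n} \<subseteq> {1..m + k}"
    using le by auto
  then have "monotone_path N n j"
    using j(1) unfolding monotone_path_def by (blast intro: monotone_on_subset)
  moreover have "\<forall>e\<in>path_edges (Suc k) n j. \<chi> e = c"
    using j(2) le by (auto simp: path_edges_Suc[OF \<open>k < n\<close>])
  ultimately show False
    using nopath by blast
qed

lemma forces_mono_path_Suc:
  assumes "1 \<le> k" and "k < n" and "1 \<le> q"
    and forces: "forces_mono_path k ((n - k) ^ (q - 1)) n N"
  shows "forces_mono_path (Suc k) q n N"
  unfolding forces_mono_path_def
proof (rule ballI, rule ccontr)
  fix \<chi> assume \<chi>: "\<chi> \<in> nsets {1..N} (Suc k) \<rightarrow> {..<q}"
  assume "\<nexists>j. monotone_path N n j \<and> (\<exists>c. \<forall>e\<in>path_edges (Suc k) n j. \<chi> e = c)"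
  then have nopath: "\<not> (\<forall>e\<in>path_edges (Suc k) n j. \<chi> e = c)" if "monotone_path N n j" for j c
    using that by blast
  let ?T = "tail_lengths \<chi> N k"
  have less: "m < n - k" if "m \<in> ?T c S" for m c S
    using tail_lengths_less[OF that \<open>k < n\<close>] nopath by blast
  then have "?T c S \<subseteq> {..<n - k}" for c S
    by blast
  then have fin: "finite (?T c S)" for c S
    by (rule finite_subset) simp
  \<comment> \<open>The colour \<open>q - 1\<close> gets no coordinate. Restricting makes the tuple
    extensional, so that it lies in the finite function space \<open>?P\<close>.\<close>
  define F where "F S = restrict (\<lambda>c. Max (?T c S)) {..<q - 1}" for S
  let ?P = "{..<q - 1} \<rightarrow>\<^sub>E {..<n - k}"
  have Max_in_T: "Max (?T c S) \<in> ?T c S" if "S \<in> nsets {1..N} k" for c S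
    using fin zero_in_tail_lengths[OF that, of \<chi> c] by (intro Max_in) auto
  have F: "F S \<in> ?P" if "S \<in> nsets {1..N} k" for S
    using less[OF Max_in_T[OF that]] by (auto simp: F_def)
  have "finite ?P" "card ?P = (n - k) ^ (q - 1)"
    by (simp_all add: finite_PiE card_PiE)
  \<comment> \<open>Colours must be initial natural numbers, so \<open>g\<close> numbers the
    tuples.\<close>
  then obtain g where g: "bij_betw g ?P {..<(n - k) ^ (q - 1)}"
    using ex_bij_betw_finite_nat[of ?P] by (auto simp: atLeast0LessThan)
  then have "(\<lambda>S. g (F S)) \<in> nsets {1..N} k \<rightarrow> {..<(n - k) ^ (q - 1)}"
    using F bij_betwE by fastforce
  then obtain j d where path: "monotone_path N n j"
    and d: "\<And>e. e \<in> path_edges k n j \<Longrightarrow> g (F e) = d"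
    using forces unfolding forces_mono_path_def by (elim ballE) auto
  have mono: "strict_mono_on {1..n} j" and range: "j ` {1..n} \<subseteq> {1..N}"
    using path by (auto simp: monotone_path_def)
  define W where "W i = j ` {i..<i + k}" for i
  have W_nsets: "W i \<in> nsets {1..N} k" if "i \<in> {1..n - k + 1}" for i
    unfolding W_def using that \<open>k < n\<close> by (intro window_in_nsets[OF mono range]) auto
  have "{i..<i + k} = {i..i + k - 1}" for i
    using \<open>1 \<le> k\<close> by auto
  then have W_edge: "W i \<in> path_edges k n j" if "i \<in> {1..n - k + 1}" for i
    unfolding W_def path_edges_def using that by simp
  have F_eq: "F (W i) = F (W (Suc i))" if "i \<in> {1..n - k}" for i
  proof -
    have "i \<in> {1..n - k + 1}" "Suc i \<in> {1..n - k + 1}"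
      using that by auto
    then have "F (W i) \<in> ?P" "F (W (Suc i)) \<in> ?P" "g (F (W i)) = g (F (W (Suc i)))"
      using F W_nsets d W_edge by auto
    then show ?thesis
      using g by (meson bij_betw_imp_inj_on inj_onD)
  qed
  \<comment> \<open>The path \<open>j\<close>, found for the \<open>k\<close>-sets, itself turns out
    to be monochromatic for \<open>\<chi>\<close>, which contradicts \<open>nopath\<close>.\<close>
  have "\<chi> (j ` {i..i + k}) = q - 1" if i: "i \<in> {1..n - k}" for i
  proof (rule ccontr)
    assume ne: "\<chi> (j ` {i..i + k}) \<noteq> q - 1"
    define c where "c = \<chi> (j ` {i..i + k})"
    have i': "i \<in> {1..n - k + 1}" "Suc i \<in> {1..n - k + 1}" "i + k \<in> {1..n}" "1 \<le> i"
      using i \<open>k < n\<close> by auto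
    have "j ` {i..<i + Suc k} \<in> nsets {1..N} (Suc k)"
      using i' by (intro window_in_nsets[OF mono range]) auto
    then have "c < q"
      using \<chi> by (auto simp: c_def atLeastLessThanSuc_atLeastAtMost)
    with ne have c: "c < q - 1"
      by (simp add: c_def)
    have lt: "x < j (i + k)" if "x \<in> W i" for x
      using that mono i' by (auto simp: W_def strict_mono_on_def)
    have "{i..i + k} = insert (i + k) {i..<i + k}"
      by auto
    then have "\<chi> (insert (j (i + k)) (W i)) = c"
      by (simp add: W_def c_def)
    moreover have "j (i + k) \<le> N"
      using range i'(3) by (auto simp: image_subset_iff)
    moreover have "strict_mono_on {i..i + k} j"
      using mono by (rule monotone_on_subset) (use i' in auto)
    then have "insert (j (i + k)) (W i - {Min (W i)}) = W (Suc i)"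
      using window_shift[of i k j] \<open>1 \<le> k\<close>
      by (simp add: W_def atLeastLessThanSuc_atLeastAtMost)
    \<comment> \<open>The longest path ending in \<open>W i\<close> need not follow
      \<open>j\<close>; it can still be extended by \<open>j (i + k)\<close>, because only its last
      window matters.\<close>
    ultimately have "Suc (Max (?T c (W i))) \<in> ?T c (W (Suc i))"
      using Suc_in_tail_lengths[OF Max_in_T[OF W_nsets[OF i'(1)]] \<open>1 \<le> k\<close> _ lt] by metis
    then have "Max (?T c (W i)) < Max (?T c (W (Suc i)))"
      using fin by (simp add: Suc_le_lessD)
    moreover have "Max (?T c (W i)) = Max (?T c (W (Suc i)))"
      using fun_cong[OF F_eq[OF i], of c] c by (simp add: F_def)
    ultimately show False
      by simp
  qed
  then have "\<forall>e\<in>path_edges (Suc k) n j. \<chi> e = q - 1"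
    by (auto simp: path_edges_Suc[OF \<open>k < n\<close>])
  then show False
    using nopath[OF path] by blast
qed

text \<open>By Ramsey's theorem there is a homogeneous set of \<open>n\<close> vertices; listed
  increasingly, it is a monochromatic path.\<close>

lemma ex_forces_mono_path:
  assumes "1 \<le> k" and "k \<le> n"
  shows "\<exists>N. forces_mono_path k Q n N"
proof -
  obtain N :: nat where N: "partn_lst {..<N} (replicate Q n) k"
    using ramsey_full by blast
  have "forces_mono_path k Q n N"
    unfolding forces_mono_path_def
  proof
    fix \<chi> assume \<chi>: "\<chi> \<in> nsets {1..N} k \<rightarrow> {..<Q}"
    \<comment> \<open>Ramsey's theorem is stated for vertices from \<open>0\<close>, paths use
      vertices from \<open>1\<close>; \<open>Suc\<close> translates.\<close>
    have "(\<lambda>e. \<chi> (Suc ` e)) \<in> nsets {..<N} k \<rightarrow> {..<Q}"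
    proof
      fix e assume "e \<in> nsets {..<N} k"
      then have "Suc ` e \<in> nsets {1..N} k"
        by (auto simp: nsets_def card_image)
      then show "\<chi> (Suc ` e) \<in> {..<Q}"
        using \<chi> by blast
    qed
    then obtain c H where "c < Q" and H: "H \<in> nsets {..<N} n"
      and c: "(\<lambda>e. \<chi> (Suc ` e)) ` nsets H k \<subseteq> {c}"
      using partn_lstE[OF N] by (metis length_replicate nth_replicate)
    obtain h where h: "strict_mono_on {1..n} h" "h ` {1..n} = H"
      using strict_mono_enumeration[of H n] H by (auto simp: nsets_def)
    let ?j = "\<lambda>i. Suc (h i)"
    have "monotone_path N n ?j"
      using h H by (auto simp: monotone_path_def strict_mono_on_def nsets_def)
    moreover have "\<chi> e = c" if "e \<in> path_edges k n ?j" for e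
    proof -
      obtain i where i: "i \<in> {1..n - k + 1}" "e = ?j ` {i..i + k - 1}"
        using \<open>e \<in> _\<close> by (auto simp: path_edges_def)
      have "{i..i + k - 1} = {i..<i + k}"
        using \<open>1 \<le> k\<close> by auto
      then have "e = Suc ` (h ` {i..<i + k})"
        using i(2) by (simp add: image_image)
      moreover have "h ` {i..<i + k} \<in> nsets H k"
        using i(1) \<open>k \<le> n\<close> h by (intro window_in_nsets[of n]) auto
      ultimately show ?thesis
        using c by auto
    qed
    ultimately show "\<exists>j. monotone_path N n j \<and> (\<exists>c. \<forall>e\<in>path_edges k n j. \<chi> e = c)"
      by blast
  qed
  then show ?thesis ..
qed

theorem theorem7:
  fixes n k q :: nat
  assumes "2 \<le> k" and "k \<le> n" and "2 \<le> q"
  shows "mono_path_ramsey k q n \<le> mono_path_ramsey (k - 1) ((n - k + 1) ^ (q - 1)) n"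
proof -
  obtain l where k: "k = Suc l" and l: "1 \<le> l" "l < n"
    using assms(1,2) by (cases k) auto
  have n: "n - k + 1 = n - l"
    using k l by simp
  let ?N = "mono_path_ramsey l ((n - l) ^ (q - 1)) n"
  \<comment> \<open>Existence is what ensures that the \<open>LEAST\<close> on the right-hand side
    really forces a path.\<close>
  have "forces_mono_path l ((n - l) ^ (q - 1)) n ?N"
    unfolding mono_path_ramsey_def using l by (intro LeastI_ex[OF ex_forces_mono_path]) simp_all
  then have "forces_mono_path k q n ?N"
    unfolding k using forces_mono_path_Suc[OF l] assms(3) by simp
  then show ?thesis
    unfolding mono_path_ramsey_def[of k] n by (simp add: Least_le k)
qed

end
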